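(* Consider the 4-player minority scenario. (i) Let $P=(4,H,J,\rho',\mathfrak U)$ be any EWL-type procedure, let $U_1,\dots,U_4\in\mathfrak U$, and for $Y=(y_1,y_2,y_3,y_4)\in\{0,1\}^4$ let $p(Y)$ be the resulting probability of output $Y$. Then the mixed separable state $$\rho=\sum_{Y\in\{0,1\}^4}p(Y)\,Q_{y_1}\otimes Q_{y_2}\otimes Q_{y_3}\otimes Q_{y_4}$$ is such that, in a procedure with initial state $\rho$ and $J=H=\mathbb 1$, the trivial strategies $U_i=\mathbb 1$ ($i=1,\dots,4$) result in the same output distribution $p$. (ii) Let $P_2=(4,\,H=\mathbb 1,\,J=\mathbb 1,\,\rho_{in},\,\mathfrak U=\{\sigma_x,\mathbb 1\})$ with $$\rho_{in}=\tfrac18\sum_{\substack{Y\in\{0,1\}^4\\ y_1+y_2+y_3+y_4\ \text{odd}}}Q_{y_1}\otimes Q_{y_2}\otimes Q_{y_3}\otimes Q_{y_4}.$$ Then, in the game implemented by $P_2$ within the 4-player minority scenario, the profile in which every player chooses $\mathbb 1$ is a Pareto-optimal Nash equilibrium; it yields $p(Y)=1/8$ for each $Y$ with an odd number of ones and $p(Y)=0$ otherwise, and gives each player payoff $1/4$.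
   Context: The 4-player minority scenario has no input, output set $\{0,1\}^4$, and evaluating functions $\$_i:\{0,1\}^4\to\mathbb R$, $i=1,\dots,4$, given by $\$_i(y_1,\dots,y_4)=1$ if $|\{j: 1\le j\le 4,\ y_j=y_i\}|<2$, and $\$_i(y_1,\dots,y_4)=0$ otherwise. An EWL-type procedure for 4 players is a tuple $(4,H,J,\rho,\mathfrak U)$, where $H,J$ are unitary operators on $(\mathbb C^2)^{\otimes 4}$, $\rho$ is a 4-qubit state (density operator), and $\mathfrak U$ is a compact set of one-qubit unitary operators (2×2 unitary matrices). Given $U_1,\dots,U_4\in\mathfrak U$, put $\mathcal U=U_1\otimes\cdots\otimes U_4$ and $\rho_f=H\,\mathcal U\,J\,\rho\,(H\,\mathcal U\,J)^\dagger$. The probability of output $Y=(y_1,\dots,y_4)$ is $p(Y)=\operatorname{Tr}\bigl((Q_{y_1}\otimes\cdots\otimes Q_{y_4})\rho_f\bigr)$, where $Q_0=|0\rangle\langle0|$ and $Q_1=|1\rangle\langle1|$. The matrix $\sigma_x$ is the Pauli matrix exchanging $|0\rangle$ and $|1\rangle$; $\mathbb 1$ is the identity operator. A state is separable if it is a convex combination of tensor products of one-qubit states. The game implemented by the procedure has pure strategy set $\mathfrak U$ for each of the four players and payoffs $\yen_i(U_1,\dots,U_4)=\sum_{Y}\$_i(Y)\,p(Y)$; payoffs of mixed strategies are expectations. A profile is Pareto-optimal if no other profile (pure or mixed) gives every player at least as large a payoff and some player a strictly larger one. A profile is a Nash equilibrium if no player can increase their own payoff by unilaterally changing strategy. *)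

theory Defs
  imports "HOL-Probability.Probability"
begin

text \<open>Players are the elements of the numeral type 4 (where \<open>4 = 0\<close>), bits those of the numeral type 2.
  The computational basis of the 4-qubit space is indexed by bit strings
  \<open>Y :: 4 \<Rightarrow> 2\<close>; accordingly a 4-qubit operator is a matrix whose rows and columns are
  indexed by bit strings.\<close>

type_synonym player = 4
type_synonym outcome = "player \<Rightarrow> 2"
type_synonym op1 = "complex ^ 2 ^ 2"
type_synonym op4 = "complex ^ outcome ^ outcome"

definition dagger :: "complex ^ 'n ^ 'm \<Rightarrow> complex ^ 'm ^ 'n" where
  "dagger A = (\<chi> i j. cnj (A $ j $ i))"

definition unitary :: "complex ^ 'n ^ 'n \<Rightarrow> bool" where
  "unitary A \<longleftrightarrow> dagger A ** A = mat 1 \<and> A ** dagger A = mat 1"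

definition positive_semidefinite :: "complex ^ 'n ^ 'n \<Rightarrow> bool" where
  "positive_semidefinite A \<longleftrightarrow>
     dagger A = A \<and> (\<forall>v. 0 \<le> Re (\<Sum>i\<in>UNIV. cnj (v $ i) * (A *v v) $ i))"

definition density_operator :: "complex ^ 'n ^ 'n \<Rightarrow> bool" where
  "density_operator A \<longleftrightarrow> positive_semidefinite A \<and> trace A = 1"

text \<open>The matrix of \<open>A 1 \<otimes> A 2 \<otimes> A 3 \<otimes> A 4\<close> in the computational basis.\<close>

definition tensor4 :: "(player \<Rightarrow> op1) \<Rightarrow> op4" where
  "tensor4 A = (\<chi> X Y. \<Prod>i\<in>UNIV. A i $ X i $ Y i)"

definition Q :: "2 \<Rightarrow> op1" where
  "Q y = (\<chi> i j. if i = y \<and> j = y then 1 else 0)"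

definition sigma_x :: op1 where
  "sigma_x = (\<chi> i j. if i = j then 0 else 1)"

definition separable :: "op4 \<Rightarrow> bool" where
  "separable \<rho> \<longleftrightarrow> \<rho> \<in> convex hull {tensor4 s | s. \<forall>i. density_operator (s i)}"


record 's game =
  strategies :: "'s set"
  utility :: "player \<Rightarrow> (player \<Rightarrow> 's) \<Rightarrow> real"

text \<open>Mixed strategies are Borel probability measures on the set of pure strategies; pure
  strategies are identified with point masses. The players randomise independently.\<close>

definition strategy_space :: "('s::topological_space) game \<Rightarrow> 's measure" where
  "strategy_space G = restrict_space borel (strategies G)"

definition mixed_strategies :: "('s::topological_space) game \<Rightarrow> 's measure set" where
  "mixed_strategies G = {\<mu>. prob_space \<mu> \<and> sets \<mu> = sets (strategy_space G)}"

definition mixed_profile :: "('s::topological_space) game \<Rightarrow> (player \<Rightarrow> 's measure) \<Rightarrow> bool" where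
  "mixed_profile G \<mu> \<longleftrightarrow> (\<forall>i. \<mu> i \<in> mixed_strategies G)"

definition pure_profile ::
    "('s::topological_space) game \<Rightarrow> (player \<Rightarrow> 's) \<Rightarrow> player \<Rightarrow> 's measure" where
  "pure_profile G s = (\<lambda>i. return (strategy_space G) (s i))"

definition expected_utility ::
    "('s::topological_space) game \<Rightarrow> (player \<Rightarrow> 's measure) \<Rightarrow> player \<Rightarrow> real" where
  "expected_utility G \<mu> i = (\<integral>s. utility G i s \<partial>(PiM UNIV \<mu>))"

definition nash_equilibrium ::
    "('s::topological_space) game \<Rightarrow> (player \<Rightarrow> 's measure) \<Rightarrow> bool" where
  "nash_equilibrium G \<mu> \<longleftrightarrow> mixed_profile G \<mu> \<and>
     (\<forall>i. \<forall>\<nu>\<in>mixed_strategies G.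
        expected_utility G (\<mu>(i := \<nu>)) i \<le> expected_utility G \<mu> i)"

definition pareto_optimal ::
    "('s::topological_space) game \<Rightarrow> (player \<Rightarrow> 's measure) \<Rightarrow> bool" where
  "pareto_optimal G \<mu> \<longleftrightarrow> mixed_profile G \<mu> \<and>
     \<not> (\<exists>\<nu>. mixed_profile G \<nu> \<and>
          (\<forall>i. expected_utility G \<mu> i \<le> expected_utility G \<nu> i) \<and>
          (\<exists>i. expected_utility G \<mu> i < expected_utility G \<nu> i))"


record ewl =
  final_op :: op4  \<comment> \<open>\<open>H\<close>\<close>
  initial_op :: op4  \<comment> \<open>\<open>J\<close>\<close>
  initial_state :: op4  \<comment> \<open>\<open>\<rho>\<close>\<close>
  moves :: "op1 set"  \<comment> \<open>\<open>\<UU>\<close>\<close>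

definition ewl_procedure :: "ewl \<Rightarrow> bool" where
  "ewl_procedure P \<longleftrightarrow>
     unitary (final_op P) \<and> unitary (initial_op P) \<and> density_operator (initial_state P) \<and>
     compact (moves P) \<and> (\<forall>U\<in>moves P. unitary U)"

definition final_state :: "ewl \<Rightarrow> (player \<Rightarrow> op1) \<Rightarrow> op4" where
  "final_state P U =
     (let W = final_op P ** tensor4 U ** initial_op P in W ** initial_state P ** dagger W)"

text \<open>The trace below is real, since the final state and the projection are Hermitian.\<close>

definition output_prob :: "ewl \<Rightarrow> (player \<Rightarrow> op1) \<Rightarrow> outcome \<Rightarrow> real" where
  "output_prob P U Y = Re (trace (tensor4 (\<lambda>i. Q (Y i)) ** final_state P U))"

text \<open>A scenario without input and with outputs in \<open>{0,1}\<^sup>4\<close> is given by its evaluating functions.\<close>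

definition implemented_game :: "(player \<Rightarrow> outcome \<Rightarrow> real) \<Rightarrow> ewl \<Rightarrow> op1 game" where
  "implemented_game v P =
     \<lparr>strategies = moves P, utility = (\<lambda>i U. \<Sum>Y\<in>UNIV. v i Y * output_prob P U Y)\<rparr>"

definition minority :: "player \<Rightarrow> outcome \<Rightarrow> real" where
  "minority i Y = (if card {j. Y j = Y i} < 2 then 1 else 0)"

text \<open>The parity of the number of ones, taken in the natural numbers.\<close>

definition odd_ones :: "outcome \<Rightarrow> bool" where
  "odd_ones Y \<longleftrightarrow> odd (card {i. Y i = 1})"

definition odd_state :: op4 where
  "odd_state = (1/8) *\<^sub>R (\<Sum>Y | odd_ones Y. tensor4 (\<lambda>i. Q (Y i)))"

definition odd_procedure :: ewl where
  "odd_procedure =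
     \<lparr>final_op = mat 1, initial_op = mat 1, initial_state = odd_state, moves = {sigma_x, mat 1}\<rparr>"

end

theory Submission imports Defs begin

text \<open>Part (i): the density matrix that is diagonal in the computational basis, with the output
  distribution on its diagonal, is separable and is left unchanged by identity moves.

  Part (ii): for each player exactly two outputs win, so a player's payoff is the sum of two output
  probabilities. Every pure profile of the odd procedure merely permutes a distribution
  bounded by \<open>1/8\<close>, so no payoff, pure or mixed, exceeds \<open>1/4\<close>; identity moves attain
  this bound for all players at once, because a lone bit makes the number of ones equal to 1 or 3.\<close>

section \<open>Four-qubit operators\<close>

lemma dagger_nth [simp]: "dagger A $ i $ j = cnj (A $ j $ i)"
  by (simp add: dagger_def)

lemma dagger_mat_1 [simp]: "dagger (mat 1) = mat 1"
  by (simp add: vec_eq_iff mat_def)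

lemma dagger_mult: "dagger (A ** B) = dagger B ** dagger A"
  by (simp add: vec_eq_iff matrix_matrix_mult_def mult.commute)

lemma unitary_mat_1 [simp]: "unitary (mat 1)"
  by (simp add: unitary_def)

lemma unitary_mult:
  assumes "unitary A" "unitary B"
  shows "unitary (A ** B)"
proof -
  have "dagger B ** dagger A ** (A ** B) = dagger B ** (dagger A ** A) ** B"
    "A ** B ** (dagger B ** dagger A) = A ** (B ** dagger B) ** dagger A"
    by (simp_all only: matrix_mul_assoc)
  then show ?thesis
    using assms by (simp add: unitary_def dagger_mult)
qed

lemma tensor4_nth [simp]: "tensor4 A $ X $ Y = (\<Prod>i\<in>UNIV. A i $ X i $ Y i)"
  by (simp add: tensor4_def)

lemma dagger_tensor4: "dagger (tensor4 A) = tensor4 (\<lambda>i. dagger (A i))"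
  by (simp add: vec_eq_iff)

lemma tensor4_mat_1 [simp]: "tensor4 (\<lambda>i. mat 1) = mat 1"
  by (auto simp: vec_eq_iff mat_def fun_eq_iff)

text \<open>Distributivity: an entry of the matrix product is a sum over intermediate bit strings
  \<open>Z\<close> of a product over qubits, and such a sum factors into one sum over a single bit
  per qubit.\<close>

lemma tensor4_mult: "tensor4 A ** tensor4 B = tensor4 (\<lambda>i. A i ** B i)"
proof -
  have "(\<Sum>Z\<in>UNIV. \<Prod>i\<in>UNIV. A i $ X i $ Z i * B i $ Z i $ Y i) =
      (\<Prod>i\<in>UNIV. \<Sum>z\<in>UNIV. A i $ X i $ z * B i $ z $ Y i)" for X Y
    by (subst prod_sum_PiE) simp_all
  then show ?thesis
    by (simp add: vec_eq_iff matrix_matrix_mult_def prod.distrib)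
qed

lemma unitary_tensor4:
  assumes "\<And>i. unitary (A i)"
  shows "unitary (tensor4 A)"
  using assms by (simp add: unitary_def dagger_tensor4 tensor4_mult)

section \<open>Projections and output probabilities\<close>

lemma Q_nth: "Q y $ i $ j = (if i = y \<and> j = y then 1 else 0)"
  by (simp add: Q_def)

lemma tensor4_Q_nth:
  "tensor4 (\<lambda>i. Q (Y i)) $ X $ Z = (if X = Y \<and> Z = Y then 1 else 0)"
  by (auto simp: Q_nth fun_eq_iff)

text \<open>The diagonal entry is the quadratic form of \<open>A\<close> at column \<open>i\<close>
  of \<open>dagger W\<close>. This is what makes output probabilities nonnegative.\<close>

lemma Re_sandwich_diagonal_nonneg:
  fixes A :: "complex ^ 'n ^ 'n" and W :: "complex ^ 'n ^ 'm"
  assumes "positive_semidefinite A"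
  shows "0 \<le> Re ((W ** A ** dagger W) $ i $ i)"
proof -
  define v :: "complex ^ 'n" where "v = (\<chi> x. cnj (W $ i $ x))"
  have "(W ** A ** dagger W) $ i $ i = (W ** (A ** dagger W)) $ i $ i"
    by (simp only: matrix_mul_assoc)
  also have "\<dots> = (\<Sum>x\<in>UNIV. cnj (v $ x) * (A *v v) $ x)"
    by (simp add: matrix_matrix_mult_def matrix_vector_mult_def v_def)
  finally show ?thesis
    using assms by (simp add: positive_semidefinite_def)
qed

lemma trace_unitary_conj:
  fixes A :: "complex ^ 'n ^ 'n"
  assumes "unitary W"
  shows "trace (W ** A ** dagger W) = trace A"
proof -
  have "trace (W ** A ** dagger W) = trace (dagger W ** (W ** A))"
    by (rule trace_mul_sym)
  then show ?thesis
    using assms by (simp add: matrix_mul_assoc unitary_def)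
qed

text \<open>The projection onto \<open>Y\<close> has its only nonzero entry at position
  \<open>(Y, Y)\<close>. From here on measurement means reading off the diagonal.\<close>

lemma output_prob_eq_diagonal: "output_prob P U Y = Re (final_state P U $ Y $ Y)"
proof -
  have "trace (tensor4 (\<lambda>i. Q (Y i)) ** A) = A $ Y $ Y" for A :: op4
  proof -
    \<comment> \<open>Nested conditions with the entry of \<open>A\<close> frozen at
      \<open>Y\<close> let both sums of the trace collapse.\<close>
    have *: "(if X = Y \<and> Z = Y then 1 else 0) * A $ Z $ X =
        (if Z = Y then if X = Y then A $ Y $ Y else 0 else 0)" for X Z
      by simp
    show ?thesis
      unfolding trace_def matrix_matrix_mult_def
      by (simp add: tensor4_Q_nth * del: tensor4_nth)
  qed
  then show ?thesis
    by (simp add: output_prob_def)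
qed

text \<open>The whole evolution is conjugation by one unitary \<open>W\<close>, which keeps the
  trace at 1 and the diagonal nonnegative.\<close>

lemma
  assumes "ewl_procedure P" "\<And>i. U i \<in> moves P"
  shows output_prob_nonneg: "0 \<le> output_prob P U Y"
    and sum_output_prob: "(\<Sum>Y\<in>UNIV. output_prob P U Y) = 1"
proof -
  define W where "W = final_op P ** tensor4 U ** initial_op P"
  have final: "final_state P U = W ** initial_state P ** dagger W"
    by (simp add: final_state_def W_def Let_def)
  have "unitary W"
    using assms unfolding W_def ewl_procedure_def
    by (intro unitary_mult unitary_tensor4) auto
  then have "trace (final_state P U) = 1"
    using assms by (simp add: final trace_unitary_conj ewl_procedure_def density_operator_def)
  then have "Re (\<Sum>Y\<in>UNIV. final_state P U $ Y $ Y) = 1"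
    by (simp add: trace_def)
  then show "(\<Sum>Y\<in>UNIV. output_prob P U Y) = 1"
    by (simp add: output_prob_eq_diagonal)
  show "0 \<le> output_prob P U Y"
    using assms unfolding output_prob_eq_diagonal final
    by (intro Re_sandwich_diagonal_nonneg) (auto simp: ewl_procedure_def density_operator_def)
qed

section \<open>Diagonal states\<close>

lemma density_operator_diagonal:
  fixes A :: "complex ^ 'n ^ 'n"
  assumes diag: "\<And>i j. A $ i $ j = (if i = j then of_real (p i) else 0)"
    and nonneg: "\<And>i. 0 \<le> p i"
    and sum: "(\<Sum>i\<in>UNIV. p i) = 1"
  shows "density_operator A"
proof -
  have "dagger A = A"
    by (auto simp: vec_eq_iff diag)
  moreover have "0 \<le> Re (\<Sum>i\<in>UNIV. cnj (v $ i) * (A *v v) $ i)" for v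
  proof -
    have "(A *v v) $ i = of_real (p i) * v $ i" for i
      by (simp add: matrix_vector_mult_def diag if_distrib[of "\<lambda>x. x * _"] cong: if_cong)
    \<comment> \<open>The quadratic form of a diagonal matrix is the sum of \<open>p i\<close> times
      the squared modulus of \<open>v $ i\<close>.\<close>
    then have "Re (cnj (v $ i) * (A *v v) $ i) = p i * ((Re (v $ i))\<^sup>2 + (Im (v $ i))\<^sup>2)" for i
      by (simp add: power2_eq_square algebra_simps)
    then show ?thesis
      by (simp add: nonneg sum_nonneg)
  qed
  moreover have "trace A = 1"
    by (simp add: trace_def diag sum flip: of_real_sum)
  ultimately show ?thesis
    by (simp add: density_operator_def positive_semidefinite_def)
qed

lemma density_operator_Q: "density_operator (Q y)"
  by (rule density_operator_diagonal[where p = "\<lambda>i. if i = y then 1 else 0"]) (auto simp: Q_nth)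

lemma diagonal_state_nth:
  "(\<Sum>Y\<in>UNIV. p Y *\<^sub>R tensor4 (\<lambda>i. Q (Y i))) $ X $ Z = (if X = Z then of_real (p X) else 0)"
proof -
  have "(p Y *\<^sub>R tensor4 (\<lambda>i. Q (Y i))) $ X $ Z =
      (if Y = X then if X = Z then of_real (p X) else 0 else 0)" for Y
    by (simp add: tensor4_Q_nth scaleR_conv_of_real[where 'a = complex] del: tensor4_nth)
  then show ?thesis
    by (simp del: tensor4_nth vector_scaleR_component)
qed

text \<open>A probability distribution on bit strings supplies the convex coefficients, and each
  basis projection is a product of one-qubit states \<open>Q (Y i)\<close>.\<close>

lemma
  assumes "\<And>Y. 0 \<le> p Y" "(\<Sum>Y\<in>UNIV. p Y) = 1"
  shows density_operator_diagonal_state: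
      "density_operator (\<Sum>Y\<in>UNIV. p Y *\<^sub>R tensor4 (\<lambda>i. Q (Y i)))"
    and separable_diagonal_state:
      "separable (\<Sum>Y\<in>UNIV. p Y *\<^sub>R tensor4 (\<lambda>i. Q (Y i)))"
proof -
  show "density_operator (\<Sum>Y\<in>UNIV. p Y *\<^sub>R tensor4 (\<lambda>i. Q (Y i)))"
    using diagonal_state_nth assms by (rule density_operator_diagonal)
  show "separable (\<Sum>Y\<in>UNIV. p Y *\<^sub>R tensor4 (\<lambda>i. Q (Y i)))"
    unfolding separable_def
  proof (rule convex_sum)
    fix Y
    have "tensor4 (\<lambda>i. Q (Y i)) \<in> {tensor4 s | s. \<forall>i. density_operator (s i)}"
      using density_operator_Q by blast
    then show "tensor4 (\<lambda>i. Q (Y i)) \<in> convex hull {tensor4 s | s. \<forall>i. density_operator (s i)}"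
      by (rule hull_inc)
  qed (use assms in \<open>auto simp: convex_convex_hull\<close>)
qed

section \<open>Pure and mixed payoffs\<close>

text \<open>In a T1 space points are closed, hence Borel.\<close>

lemma singleton_in_sets_strategy_space:
  fixes G :: "('s::t1_space) game"
  assumes "x \<in> strategies G"
  shows "{x} \<in> sets (strategy_space G)"
  using assms unfolding strategy_space_def sets_restrict_space
  by (intro image_eqI[where x = "{x}"]) auto

lemma space_strategy_space [simp]: "space (strategy_space G) = strategies G"
  by (simp add: strategy_space_def space_restrict_space)

lemma pure_profile_mixed_profile:
  assumes "\<And>i. s i \<in> strategies G"
  shows "mixed_profile G (pure_profile G s)"
  using assms
  by (simp add: mixed_profile_def mixed_strategies_def pure_profile_def prob_space_return)

text \<open>A product of point masses is the point mass at \<open>s\<close>. Evaluating the integral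
  there requires a measurable utility, which finiteness of the strategy set provides.\<close>

lemma expected_utility_pure_profile:
  fixes G :: "('s::t1_space) game"
  assumes "finite (strategies G)" and s: "\<And>i. s i \<in> strategies G"
  shows "expected_utility G (pure_profile G s) i = utility G i s"
proof -
  let ?M = "PiM UNIV (\<lambda>_::player. strategy_space G)"
  have space: "space ?M = (UNIV \<rightarrow> strategies G)"
    by (simp add: space_PiM PiE_UNIV_domain)
  have fin: "finite (space ?M)"
    using assms by (simp add: space_PiM finite_PiE)
  have sing: "{t} \<in> sets ?M" if "t \<in> space ?M" for t
  proof -
    have "{t} = (\<Pi>\<^sub>E j\<in>UNIV. {t j})"
      by (auto simp: PiE_UNIV_domain fun_eq_iff)
    also have "\<dots> \<in> sets ?M"
      using that by (intro sets_PiM_I_finite) (auto simp: space intro!: singleton_in_sets_strategy_space)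
    finally show ?thesis .
  qed
  \<comment> \<open>On a finite space with measurable points, any function is a finite combination
    of indicators of points.\<close>
  have "(\<lambda>x. \<Sum>t\<in>space ?M. indicat_real {t} x * utility G i t) \<in> borel_measurable ?M"
    using sing by (intro borel_measurable_sum borel_measurable_times) auto
  also have "?this \<longleftrightarrow> utility G i \<in> borel_measurable ?M"
    using fin by (intro measurable_cong) (simp add: indicator_def of_bool_def if_distrib[of "\<lambda>x. x * _"] cong: if_cong)
  finally have "utility G i \<in> borel_measurable ?M" .
  then show ?thesis
    using s singleton_in_sets_strategy_space[of _ G]
    by (simp add: expected_utility_def pure_profile_def PiM_return integral_return space restrict_UNIV)
qed

lemma expected_utility_le:
  assumes profile: "mixed_profile G \<mu>"
    and bound: "\<And>s. (\<And>j. s j \<in> strategies G) \<Longrightarrow> utility G i s \<le> c" and "0 \<le> c"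
  shows "expected_utility G \<mu> i \<le> c"
proof (cases "integrable (PiM UNIV \<mu>) (utility G i)")
  case True
  interpret prob_space "PiM UNIV \<mu>"
    using profile by (intro prob_space_PiM) (auto simp: mixed_profile_def mixed_strategies_def)
  have "space (\<mu> j) = strategies G" for j
    using profile sets_eq_imp_space_eq[of "\<mu> j" "strategy_space G"]
    by (simp add: mixed_profile_def mixed_strategies_def)
  then have "AE s in PiM UNIV \<mu>. utility G i s \<le> c"
    by (intro AE_I2 bound) (auto simp: space_PiM PiE_UNIV_domain)
  then show ?thesis
    unfolding expected_utility_def by (intro integral_le_const True) auto
next
  case False
  \<comment> \<open>The Bochner integral of a non-integrable function is 0 by convention; this is
    where \<open>0 \<le> c\<close> enters.\<close>
  then show ?thesis
    using \<open>0 \<le> c\<close> by (simp add: expected_utility_def not_integrable_integral_eq)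
qed

section \<open>The odd procedure\<close>

text \<open>Arithmetic in the type \<open>2\<close> is modulo 2, so adding 1 is the bit flip;
  inequalities between bits become equations.\<close>

lemma two_neq_iff: "a \<noteq> b \<longleftrightarrow> a = b + (1::2)"
proof -
  have "\<forall>a b::2. a \<noteq> b \<longleftrightarrow> a = b + 1"
    by (simp add: forall_2)
  then show ?thesis
    by blast
qed

text \<open>Flipping the bit of player 1 is an involution \<open>h\<close> that reverses parity, so
  exactly half of the 16 bit strings are odd.\<close>

lemma card_odd_ones: "card {Y. odd_ones Y} = 8"
proof -
  define h :: "outcome \<Rightarrow> outcome" where "h Y = Y(1 := Y 1 + 1)" for Y
  have hh: "h (h Y) = Y" for Y
    using exhaust_2[of "Y 1"] by (auto simp: h_def)
  have odd_h: "odd_ones (h Y) \<longleftrightarrow> \<not> odd_ones Y" for Y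
  proof (cases "Y 1 = 1")
    case True
    then have "{i. Y i = 1} = insert 1 {i. h Y i = 1}" "1 \<notin> {i. h Y i = 1}"
      by (auto simp: h_def)
    then show ?thesis
      by (simp add: odd_ones_def)
  next
    case False
    then have "{i. h Y i = 1} = insert 1 {i. Y i = 1}" "1 \<notin> {i. Y i = 1}"
      using two_neq_iff[of "Y 1" 1] by (auto simp: h_def)
    then show ?thesis
      by (simp add: odd_ones_def)
  qed
  have "bij_betw h {Y. odd_ones Y} {Y. \<not> odd_ones Y}"
    by (rule bij_betwI[where g = h]) (auto simp: hh odd_h)
  then have "card {Y. odd_ones Y} = card {Y. \<not> odd_ones Y}"
    by (rule bij_betw_same_card)
  moreover have "card {Y. odd_ones Y} + card {Y. \<not> odd_ones Y} = card (UNIV :: outcome set)"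
    by (subst card_Un_disjoint[symmetric]) (auto intro: arg_cong[where f = card])
  ultimately show ?thesis
    by (simp add: card_fun)
qed

text \<open>Giving the even strings weight 0 extends the sum to all strings, so the results on
  diagonal states apply.\<close>

lemma odd_state_eq_diagonal_state:
  "odd_state = (\<Sum>Y\<in>UNIV. (if odd_ones Y then 1/8 else 0) *\<^sub>R tensor4 (\<lambda>i. Q (Y i)))"
  by (simp add: odd_state_def scaleR_sum_right sum.If_cases if_distrib[of "\<lambda>x. x *\<^sub>R _"] cong: if_cong)

lemma odd_state_nth: "odd_state $ X $ Z = (if X = Z \<and> odd_ones X then 1/8 else 0)"
  unfolding odd_state_eq_diagonal_state diagonal_state_nth by simp

lemma ewl_procedure_odd_procedure: "ewl_procedure odd_procedure"
proof -
  have "density_operator odd_state"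
    unfolding odd_state_eq_diagonal_state
    by (rule density_operator_diagonal_state) (auto simp: sum.If_cases card_odd_ones)
  moreover have "unitary sigma_x"
    by (simp add: unitary_def vec_eq_iff matrix_matrix_mult_def sigma_x_def mat_def forall_2 sum_2)
  ultimately show ?thesis
    by (simp add: ewl_procedure_def odd_procedure_def)
qed

text \<open>The move \<open>sigma_x\<close> acts on outputs as a bit flip, so a pure profile permutes the output
  distribution.\<close>

lemma output_prob_odd_procedure:
  assumes "\<And>i. U i \<in> {sigma_x, mat 1}"
  shows "output_prob odd_procedure U Y =
    (if odd_ones (\<lambda>i. if U i = mat 1 then Y i else Y i + 1) then 1/8 else 0)"
proof -
  \<comment> \<open>\<open>X\<close> is the basis string that the moves carry to \<open>Y\<close>:
    row \<open>Y\<close> of \<open>tensor4 U\<close> has its only nonzero entry in column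
    \<open>X\<close>.\<close>
  define X where "X = (\<lambda>i. if U i = mat 1 then Y i else Y i + 1)"
  have [simp]: "sigma_x \<noteq> mat 1"
    by (simp add: vec_eq_iff sigma_x_def mat_def)
  have "U i $ Y i $ z = (if z = X i then 1 else 0)" for i z
    using assms[of i] two_neq_iff[of z "Y i"] by (auto simp: X_def sigma_x_def mat_def)
  then have tensor: "tensor4 U $ Y $ Z = (if Z = X then 1 else 0)" for Z
    by (auto simp: fun_eq_iff)
  have "(tensor4 U ** odd_state ** dagger (tensor4 U)) $ Y $ Y = odd_state $ X $ X"
    by (simp add: matrix_matrix_mult_def tensor if_distrib[of "\<lambda>x. x * _"] if_distrib[of "\<lambda>x. _ * x"]
        if_distrib[of cnj] del: tensor4_nth cong: if_cong)
  then show ?thesis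
    unfolding output_prob_eq_diagonal X_def[symmetric]
    by (simp add: final_state_def odd_procedure_def Let_def odd_state_nth)
qed

text \<open>Player \<open>i\<close> wins exactly when the other three all show the opposite bit, so
  a winning output is determined by the bit \<open>b\<close> of player \<open>i\<close>.\<close>

lemma utility_minority:
  fixes U :: "player \<Rightarrow> op1"
  shows "utility (implemented_game minority P) i U =
    (\<Sum>b\<in>UNIV. output_prob P U (\<lambda>j. if j = i then b else b + 1))"
proof -
  define m :: "2 \<Rightarrow> outcome" where "m b = (\<lambda>j. if j = i then b else b + 1)" for b
  have "inj m"
    \<comment> \<open>Evaluating \<open>m b\<close> at \<open>i\<close> recovers
      \<open>b\<close>.\<close>
    by (rule injI) (metis m_def)
  have "minority i Y = (if Y \<in> range m then 1 else 0)" for Y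
  proof -
    \<comment> \<open>The set always contains \<open>i\<close>, so having fewer than two elements
      forces it to be \<open>{i}\<close>.\<close>
    have "card {j. Y j = Y i} < 2 \<longleftrightarrow> card {j. Y j = Y i} \<le> card {i}"
      by (simp add: numeral_2_eq_2 less_Suc_eq_le)
    also have "\<dots> \<longleftrightarrow> {j. Y j = Y i} = {i}"
      using card_seteq[of "{j. Y j = Y i}" "{i}"] by auto
    also have "\<dots> \<longleftrightarrow> (\<forall>j. j \<noteq> i \<longrightarrow> Y j = Y i + 1)"
      by (auto simp flip: two_neq_iff)
    also have "\<dots> \<longleftrightarrow> Y = m (Y i)"
      by (auto simp: m_def fun_eq_iff)
    also have "\<dots> \<longleftrightarrow> Y \<in> range m"
      by (auto simp: m_def)
    finally show ?thesis
      by (simp add: minority_def)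
  qed
  then have "utility (implemented_game minority P) i U = (\<Sum>Y\<in>range m. output_prob P U Y)"
    by (simp add: implemented_game_def sum.If_cases if_distrib[of "\<lambda>x. x * _"] cong: if_cong)
  also have "\<dots> = (\<Sum>b\<in>UNIV. output_prob P U (m b))"
    using \<open>inj m\<close> by (simp add: sum.reindex)
  finally show ?thesis
    by (simp add: m_def)
qed

text \<open>Puts both winning outputs of every player in the support of \<open>odd_state\<close>:
  there is a single one if \<open>b = 1\<close>, and three ones otherwise.\<close>

lemma odd_ones_minority:
  fixes i :: player
  shows "odd_ones (\<lambda>j. if j = i then b else b + 1)"
proof (cases "b = 1")
  case True
  then have "{j. (if j = i then b else b + 1) = 1} = {i}"
    by auto
  then show ?thesis
    by (simp add: odd_ones_def)
next
  case False
  then have "{j. (if j = i then b else b + 1) = 1} = UNIV - {i}"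
    using two_neq_iff[of b 1] by auto
  then show ?thesis
    by (simp add: odd_ones_def card_Diff_singleton)
qed

text \<open>In the first part \<open>M\<close> ranges over all compact sets of unitaries containing
  \<open>mat 1\<close>, since the trivial moves must be available.\<close>

theorem mainTheorem2:
  "(\<forall>P U. ewl_procedure P \<and> (\<forall>i. U i \<in> moves P) \<longrightarrow>
      (let p = output_prob P U;
           \<rho> = (\<Sum>Y\<in>UNIV. p Y *\<^sub>R tensor4 (\<lambda>i. Q (Y i)))
       in density_operator \<rho> \<and> separable \<rho> \<and>
          (\<forall>M. compact M \<and> (\<forall>V\<in>M. unitary V) \<and> mat 1 \<in> M \<longrightarrow>
             (let P' = \<lparr>final_op = mat 1, initial_op = mat 1, initial_state = \<rho>, moves = M\<rparr>
              in ewl_procedure P' \<and> (\<forall>Y. output_prob P' (\<lambda>i. mat 1) Y = p Y)))))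
   \<and>
   (let G = implemented_game minority odd_procedure;
        I = (\<lambda>i. mat 1)
    in ewl_procedure odd_procedure \<and>
       pareto_optimal G (pure_profile G I) \<and>
       nash_equilibrium G (pure_profile G I) \<and>
       (\<forall>Y. output_prob odd_procedure I Y = (if odd_ones Y then 1/8 else 0)) \<and>
       (\<forall>i. utility G i I = 1/4 \<and> expected_utility G (pure_profile G I) i = 1/4))"
proof (rule conjI, intro allI impI)
  fix P and U :: "player \<Rightarrow> op1"
  assume "ewl_procedure P \<and> (\<forall>i. U i \<in> moves P)"
  then have P: "ewl_procedure P" "\<And>i. U i \<in> moves P"
    by auto
  define p where "p = output_prob P U"
  define \<rho> where "\<rho> = (\<Sum>Y\<in>UNIV. p Y *\<^sub>R tensor4 (\<lambda>i. Q (Y i)))"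
  have density: "density_operator \<rho>" and "separable \<rho>"
    unfolding \<rho>_def p_def using output_prob_nonneg[OF P] sum_output_prob[OF P]
    by (rule density_operator_diagonal_state, rule separable_diagonal_state)
  moreover have "ewl_procedure P' \<and> (\<forall>Y. output_prob P' (\<lambda>i. mat 1) Y = p Y)"
    if "compact M \<and> (\<forall>V\<in>M. unitary V) \<and> mat 1 \<in> M"
      and P': "P' = \<lparr>final_op = mat 1, initial_op = mat 1, initial_state = \<rho>, moves = M\<rparr>"
    for M P'
  proof -
    \<comment> \<open>With all operators equal to the identity the final state is
      \<open>\<rho>\<close> itself, whose diagonal is \<open>p\<close>.\<close>
    have "\<rho> $ Y $ Y = of_real (p Y)" for Y
      unfolding \<rho>_def diagonal_state_nth by simp
    then have "output_prob P' (\<lambda>i. mat 1) Y = p Y" for Y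
      by (simp add: output_prob_eq_diagonal final_state_def P')
    then show ?thesis
      using that density by (simp add: ewl_procedure_def)
  qed
  ultimately show "let p = output_prob P U;
           \<rho> = (\<Sum>Y\<in>UNIV. p Y *\<^sub>R tensor4 (\<lambda>i. Q (Y i)))
       in density_operator \<rho> \<and> separable \<rho> \<and>
          (\<forall>M. compact M \<and> (\<forall>V\<in>M. unitary V) \<and> mat 1 \<in> M \<longrightarrow>
             (let P' = \<lparr>final_op = mat 1, initial_op = mat 1, initial_state = \<rho>, moves = M\<rparr>
              in ewl_procedure P' \<and> (\<forall>Y. output_prob P' (\<lambda>i. mat 1) Y = p Y)))"
    unfolding Let_def p_def[symmetric] \<rho>_def[symmetric] by blast
next
  define G where "G = implemented_game minority odd_procedure"
  define I :: "player \<Rightarrow> op1" where "I = (\<lambda>i. mat 1)"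
  have strategies: "strategies G = {sigma_x, mat 1}"
    by (simp add: G_def implemented_game_def odd_procedure_def)
  then have I: "I i \<in> strategies G" for i
    by (simp add: I_def)
  have prob: "output_prob odd_procedure I Y = (if odd_ones Y then 1/8 else 0)" for Y
    by (simp add: output_prob_odd_procedure I_def)
  then have utility_I: "utility G i I = 1/4" for i
    by (simp add: G_def utility_minority odd_ones_minority sum_2)
  then have expected_I: "expected_utility G (pure_profile G I) i = 1/4" for i
    using I by (simp add: expected_utility_pure_profile strategies)
  \<comment> \<open>Under any pure profile each of the two winning outputs has probability 0 or
    1/8.\<close>
  have "utility G i s \<le> 1/4" if "\<And>j. s j \<in> strategies G" for i s
    using that unfolding strategies
    by (simp add: G_def utility_minority output_prob_odd_procedure sum_2)
  then have le: "expected_utility G \<mu> i \<le> 1/4" if "mixed_profile G \<mu>" for \<mu> i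
    using that by (intro expected_utility_le) auto
  have profile: "mixed_profile G (pure_profile G I)"
    using I by (rule pure_profile_mixed_profile)
  \<comment> \<open>Every player already receives the maximum 1/4, so no profile can be strictly
    better for anyone.\<close>
  have "pareto_optimal G (pure_profile G I)"
    unfolding pareto_optimal_def expected_I using profile le by (meson leD)
  \<comment> \<open>A unilateral deviation is again a mixed profile, so the same bound 1/4 applies
    to it.\<close>
  moreover have "nash_equilibrium G (pure_profile G I)"
    unfolding nash_equilibrium_def expected_I
  proof (intro conjI allI ballI le)
    show "mixed_profile G ((pure_profile G I)(i := \<nu>))" if "\<nu> \<in> mixed_strategies G" for i \<nu>
      using profile that by (simp add: mixed_profile_def)
  qed (rule profile)
  ultimately show "let G = implemented_game minority odd_procedure;
        I = (\<lambda>i. mat 1)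
    in ewl_procedure odd_procedure \<and>
       pareto_optimal G (pure_profile G I) \<and>
       nash_equilibrium G (pure_profile G I) \<and>
       (\<forall>Y. output_prob odd_procedure I Y = (if odd_ones Y then 1/8 else 0)) \<and>
       (\<forall>i. utility G i I = 1/4 \<and> expected_utility G (pure_profile G I) i = 1/4)"
    unfolding Let_def G_def[symmetric] I_def[symmetric]
    using ewl_procedure_odd_procedure prob utility_I expected_I by blast
qed

end
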